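(* For every integer $n\ge 1$ and every integer $K \ge 1$, $$f_n\!\left(K\cdot\frac{\prod_{1\le i\le n} p_i}{p_n-1}\right) = f_{n-1}\!\left(K\cdot\prod_{1\le i\le n-1} p_i\right).$$
   Context: $p_i$ denotes the $i$-th prime number ($p_1=2$, $p_2=3$, $p_3=5,\dots$). An integer is called an $n$-prime if it is not divisible by any of the first $n$ primes $p_1,\dots,p_n$ (so every integer is a $0$-prime). For a real number $x\ge 0$, $f_n(x)$ denotes the number of positive $n$-primes $\le x$. An empty product equals $1$. *)

theory Defs
  imports Complex_Main "HOL-Computational_Algebra.Primes" "HOL-Library.Infinite_Set"
begin

(* 1-based: nth_prime 1 = 2, nth_prime 2 = 3, ...  The function enumerate counts from 0,
   and the value nth_prime 0 is meaningless. *)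
definition nth_prime :: "nat \<Rightarrow> nat" where
  "nth_prime i = enumerate {p::nat. prime p} (i - 1)"

definition n_prime :: "nat \<Rightarrow> int \<Rightarrow> bool" where
  "n_prime n m \<longleftrightarrow> (\<forall>i\<in>{1..n}. \<not> int (nth_prime i) dvd m)"

definition n_prime_count :: "nat \<Rightarrow> real \<Rightarrow> nat" where
  "n_prime_count n x = card {m::int. 0 < m \<and> real_of_int m \<le> x \<and> n_prime n m}"

lemma prime_nth_prime: "prime (nth_prime i)"
  using enumerate_in_set[OF primes_infinite] by (simp add: nth_prime_def)

lemma bij_betw_nth_prime: "bij_betw nth_prime {1..} {p. prime p}"
proof -
  have "bij_betw (\<lambda>i::nat. i - 1) {1..} UNIV"
    by (rule bij_betw_byWitness[where f' = Suc]) auto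
  then show ?thesis
    using bij_betw_trans[OF _ bij_enumerate[OF primes_infinite]]
    by (auto simp: nth_prime_def o_def cong: bij_betw_cong)
qed

lemma nth_prime_strict_mono: "1 \<le> i \<Longrightarrow> i < j \<Longrightarrow> nth_prime i < nth_prime j"
  unfolding nth_prime_def by (rule enumerate_mono[OF _ primes_infinite]) simp

(* The set counted by n_prime_count is finite, so card returns its true size. *)
lemma finite_n_primes: "finite {m::int. 0 < m \<and> real_of_int m \<le> x \<and> n_prime n m}"
  by (rule finite_subset[of _ "{0<..\<lfloor>x\<rfloor>}"]) (auto simp: le_floor_iff)

end

theory Submission
  imports Defs
begin

text \<open>Let \<open>q = p\<^sub>1 \<cdots> p\<^bsub>n-1\<^esub>\<close> and \<open>p = p\<^sub>n\<close>. Sieving out the multiples of \<open>p\<close> gives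
  \<open>f\<^sub>n(x) = f\<^bsub>n-1\<^esub>(x) - f\<^bsub>n-1\<^esub>(x / p)\<close>, and periodicity modulo \<open>q\<close> gives
  \<open>f\<^bsub>n-1\<^esub>(K q + y) = f\<^bsub>n-1\<^esub>(K q) + f\<^bsub>n-1\<^esub>(y)\<close>. For \<open>y = K q / (p - 1)\<close> the argument
  \<open>x = K q p / (p - 1)\<close> satisfies both \<open>x = K q + y\<close> and \<open>x / p = y\<close>, so the terms
  \<open>f\<^bsub>n-1\<^esub>(y)\<close> cancel.\<close>

lemma n_prime_Suc: "n_prime (Suc n) m \<longleftrightarrow> n_prime n m \<and> \<not> int (nth_prime (Suc n)) dvd m"
  by (auto simp: n_prime_def atLeastAtMostSuc_conv)

text \<open>A prime of larger index is coprime to each of the first \<open>n\<close> primes, so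
  multiplying by it creates no new divisor among them.\<close>

lemma n_prime_nth_prime_mult:
  assumes "n < k"
  shows "n_prime n (int (nth_prime k) * m) \<longleftrightarrow> n_prime n m"
proof -
  have "int (nth_prime i) dvd int (nth_prime k) * m \<longleftrightarrow> int (nth_prime i) dvd m"
    if "i \<in> {1..n}" for i
  proof -
    \<comment> \<open>Monotonicity needs \<open>1 \<le> i\<close>, which membership in
      \<open>{1..n}\<close> supplies; the indices 0 and 1 share the value 2.\<close>
    have "nth_prime i \<noteq> nth_prime k"
      using nth_prime_strict_mono[of i k] that assms by auto
    then have "coprime (int (nth_prime i)) (int (nth_prime k))"
      by (simp add: primes_coprime prime_nth_prime)
    then show ?thesis
      by (simp add: coprime_dvd_mult_right_iff)
  qed
  then show ?thesis
    by (simp add: n_prime_def)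
qed

lemma n_prime_add_primorial_multiple:
  "n_prime n (k * (\<Prod>i\<in>{1..n}. int (nth_prime i)) + m) \<longleftrightarrow> n_prime n m"
proof -
  have "int (nth_prime j) dvd k * (\<Prod>i\<in>{1..n}. int (nth_prime i))" if "j \<in> {1..n}" for j
    using that by (intro dvd_mult dvd_prodI) auto
  then show ?thesis
    by (simp add: n_prime_def dvd_add_right_iff)
qed

text \<open>The \<open>n\<close>-primes up to \<open>x\<close> divisible by the next prime
  \<open>p\<close> are exactly \<open>p\<close> times the \<open>n\<close>-primes up to
  \<open>x / p\<close>. The sum form avoids truncated subtraction.\<close>

lemma n_prime_count_sieve:
  "n_prime_count n x = n_prime_count (Suc n) x + n_prime_count n (x / real (nth_prime (Suc n)))"
proof -
  define p where "p = int (nth_prime (Suc n))"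
  have p: "0 < p"
    unfolding p_def using prime_gt_0_nat[OF prime_nth_prime] by simp
  let ?S = "\<lambda>n x. {m::int. 0 < m \<and> real_of_int m \<le> x \<and> n_prime n m}"
  let ?D = "(*) p ` ?S n (x / real_of_int p)"
  have "?S n x = ?S (Suc n) x \<union> ?D"
  proof (intro equalityI subsetI)
    fix m assume m: "m \<in> ?S n x"
    show "m \<in> ?S (Suc n) x \<union> ?D"
    proof (cases "p dvd m")
      case True
      then obtain j where "m = p * j" ..
      with m p n_prime_nth_prime_mult[of n "Suc n" j] show ?thesis
        by (auto simp: p_def[symmetric] zero_less_mult_iff field_simps)
    next
      case False
      with m show ?thesis by (simp add: n_prime_Suc p_def)
    qed
  next
    fix m assume "m \<in> ?S (Suc n) x \<union> ?D"
    with p show "m \<in> ?S n x"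
      using n_prime_nth_prime_mult[of n "Suc n"]
      by (auto simp: p_def[symmetric] n_prime_Suc field_simps)
  qed
  moreover have "?S (Suc n) x \<inter> ?D = {}"
    by (auto simp: n_prime_Suc p_def)
  ultimately have "card (?S n x) = card (?S (Suc n) x) + card ?D"
    using finite_n_primes by (simp add: card_Un_disjoint)
  moreover have "card ?D = card (?S n (x / real_of_int p))"
    using p by (intro card_image) (auto simp: inj_on_def)
  ultimately show ?thesis
    by (simp add: n_prime_count_def p_def)
qed

text \<open>Cut at \<open>c\<close>: by periodicity the \<open>n\<close>-primes above
  \<open>c\<close> and up to \<open>c + y\<close> are the translates by \<open>c\<close> of those up
  to \<open>y\<close>. The real \<open>y\<close> need not be an integer, as its later value
  \<open>c / (p - 1)\<close> requires.\<close>

lemma n_prime_count_add_primorial_multiple: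
  fixes k :: int and n :: nat
  assumes "0 \<le> k" "0 \<le> y"
  defines "c \<equiv> real_of_int k * (\<Prod>i\<in>{1..n}. real (nth_prime i))"
  shows "n_prime_count n (c + y) = n_prime_count n c + n_prime_count n y"
proof -
  \<comment> \<open>\<open>q\<close> is \<open>c\<close> as an integer, so translation by it acts on
    the counted sets.\<close>
  define q where "q = k * (\<Prod>i\<in>{1..n}. int (nth_prime i))"
  have c: "c = real_of_int q"
    by (simp add: c_def q_def)
  have q: "0 \<le> q"
    unfolding q_def using assms by (intro mult_nonneg_nonneg prod_nonneg) auto
  have shift: "n_prime n (q + m) \<longleftrightarrow> n_prime n m" for m
    unfolding q_def by (rule n_prime_add_primorial_multiple)
  let ?S = "\<lambda>x. {m::int. 0 < m \<and> real_of_int m \<le> x \<and> n_prime n m}"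
  have "?S (c + y) = ?S c \<union> (+) q ` ?S y"
  proof (intro equalityI subsetI)
    fix m assume m: "m \<in> ?S (c + y)"
    show "m \<in> ?S c \<union> (+) q ` ?S y"
    proof (cases "m \<le> q")
      case True
      with m show ?thesis by (simp add: c)
    next
      case False
      with m shift[of "m - q"] have "m - q \<in> ?S y" by (simp add: c)
      then have "q + (m - q) \<in> (+) q ` ?S y" by (rule imageI)
      then show ?thesis by simp
    qed
  next
    fix m assume "m \<in> ?S c \<union> (+) q ` ?S y"
    with q assms(2) show "m \<in> ?S (c + y)"
      by (auto simp: c shift)
  qed
  moreover have "?S c \<inter> (+) q ` ?S y = {}"
    by (auto simp: c)
  ultimately have "card (?S (c + y)) = card (?S c) + card ((+) q ` ?S y)"
    using finite_n_primes by (simp add: card_Un_disjoint)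
  then show ?thesis
    by (simp add: n_prime_count_def card_image)
qed

theorem theorem7:
  fixes n :: nat and K :: int
  assumes "n \<ge> 1" and "K \<ge> 1"
  shows "n_prime_count n (real_of_int K * ((\<Prod>i\<in>{1..n}. real (nth_prime i)) / (real (nth_prime n) - 1)))
       = n_prime_count (n - 1) (real_of_int K * (\<Prod>i\<in>{1..n - 1}. real (nth_prime i)))"
proof -
  obtain l where n: "n = Suc l"
    using assms(1) by (cases n) auto
  define p where "p = real (nth_prime n)"
  define c where "c = real_of_int K * (\<Prod>i\<in>{1..l}. real (nth_prime i))"
  define x where "x = real_of_int K * ((\<Prod>i\<in>{1..n}. real (nth_prime i)) / (p - 1))"
  have p: "1 < p"
    unfolding p_def using prime_gt_1_nat[OF prime_nth_prime] by simp
  \<comment> \<open>The last factor of the product over \<open>{1..n}\<close> is \<open>p\<close>;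
    the remaining ones belong to \<open>c\<close>.\<close>
  have x: "x = c * p / (p - 1)"
    by (simp add: x_def c_def p_def n)
  have "0 \<le> c"
    unfolding c_def using assms(2) by (intro mult_nonneg_nonneg prod_nonneg) auto
  then have "n_prime_count l (c + c / (p - 1)) = n_prime_count l c + n_prime_count l (c / (p - 1))"
    unfolding c_def using assms(2) p by (intro n_prime_count_add_primorial_multiple) auto
  moreover have "x = c + c / (p - 1)" "x / p = c / (p - 1)"
    using p by (simp_all add: x field_simps)
  ultimately have "n_prime_count n x = n_prime_count l c"
    using n_prime_count_sieve[of l x] by (simp add: n p_def)
  then show ?thesis
    by (simp add: x_def p_def c_def n)
qed

end
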